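(* Let $p,k\ge 2$ and let $G=(N^k,\Theta)$ be a downward directed lattice graph. Let $S=\{\hat t_D \mid D\subset N^k,\ |D|<\infty\}$ be the family of terminal path label functions of the induced subgraphs $G_D$. Then some $f\in S$ has at most $k^k$ regressive values on some Cartesian power $E^k\subseteq \mathrm{domain}(f)$ with $E\subset N$, $|E|=p$. In fact, some $f\in S$ is regressively regular over some $E\subset N$ of cardinality $p$.
   Context: Background theory: ZFC together with the axiom "for every $n\ge 1$ there exists an $n$-subtle cardinal". Here a limit ordinal $\lambda$ is $n$-subtle if for every closed unbounded $C\subseteq\lambda$ and every function $S$ assigning to each $n$-element subset $A$ of $\lambda$ a set $S(A)\subseteq\min(A)$, there is an $(n+1)$-element set $B\subseteq C$ such that for all $n$-element subsets $A,A'$ of $B$, $S(A)\cap\min(A\cup A')=S(A')\cap\min(A\cup A')$. $N$ is the set of nonnegative integers. For $z=(n_1,\dots,n_k)\in N^k$, $\max(z)$ and $\min(z)$ are the maximum and minimum of its coordinates. A directed graph $G=(N^k,\Theta)$ is a downward directed lattice graph if every $(x,y)\in\Theta$ satisfies $\max(x)>\max(y)$. For $D\subset N^k$, $G_D=(D,\Theta_D)$ is the induced subgraph, $\Theta_D=\{(x,y)\in\Theta\mid x,y\in D\}$. A path in $G_D$ is a sequence $(x_1,\dots,x_t)$, $t\ge1$, of distinct vertices of $D$ with $(x_i,x_{i+1})\in\Theta_D$ for $1\le i<t$ (so $(x)$ is a path for each $x\in D$). It is terminal if there is no path of the form $(x_1,\dots,x_t,x_{t+1})$. For finite $D$ and $z\in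 D$, let $T_D(z)$ be the set of last vertices of terminal paths starting at $z$. Define $\hat t_D:D\to N$ by $\hat t_D(z)=\max(z)$ if $(z)$ is terminal, and $\hat t_D(z)=\min\{\min(x)\mid x\in T_D(z)\}$ otherwise. An integer $n$ is a regressive value of $f$ on $X\subseteq N^k$ if there is $x\in X$ with $f(x)=n<\min(x)$. Two tuples $x=(n_1,\dots,n_k)$, $y=(m_1,\dots,m_k)$ have the same order type if $\{(i,j)\mid n_i<n_j\}=\{(i,j)\mid m_i<m_j\}$ and $\{(i,j)\mid n_i=n_j\}=\{(i,j)\mid m_i=m_j\}$. For finite $D\subset N^k$ and $E\subset N$ with $E^k\subseteq D$, $f:D\to N$ is regressively regular over $E$ if for each order type $ot$ of $k$-tuples one of the following holds: (1) for all $x,y\in E^k$ of order type $ot$, $f(x)=f(y)<\min(E)$; (2) for all $x\in E^k$ of order type $ot$, $f(x)\ge\min(x)$. *)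

theory Defs
  imports Main "HOL-Library.NList"
begin

section \<open>Subtle ordinals\<close>

text \<open>
  An ordinal \<open>\<lambda>\<close> is a well-order \<open>r\<close> (\<open>Well_order r\<close>) on some subset of a type. Its elements,
  i.e. the ordinals below \<open>\<lambda>\<close>, are the members of \<open>Field r\<close>, and an ordinal \<open>\<alpha> < \<lambda>\<close>, viewed as
  the set of its predecessors, is \<open>underS r \<alpha>\<close>. A cardinal is a well-order satisfying the
  library predicate \<open>Card_order\<close>.
\<close>

definition limit_ordinal :: "'a rel \<Rightarrow> bool" where
  "limit_ordinal r \<longleftrightarrow>
     Well_order r \<and> Field r \<noteq> {} \<and> (\<forall>\<alpha>\<in>Field r. \<exists>\<beta>\<in>Field r. \<alpha> \<in> underS r \<beta>)"

definition unbounded_in :: "'a rel \<Rightarrow> 'a set \<Rightarrow> 'a set \<Rightarrow> bool" where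
  "unbounded_in r C X \<longleftrightarrow> (\<forall>\<alpha>\<in>X. \<exists>\<beta>\<in>C \<inter> X. \<alpha> \<in> underS r \<beta>)"

text \<open>
  A nonzero \<open>\<delta>\<close> in which \<open>C \<inter> \<delta>\<close> is unbounded (in the strict sense above) is automatically a
  limit, so the last clause below says that \<open>C\<close> contains its limit points below \<open>\<lambda>\<close>.
\<close>

definition closed_unbounded :: "'a rel \<Rightarrow> 'a set \<Rightarrow> bool" where
  "closed_unbounded r C \<longleftrightarrow>
     C \<subseteq> Field r \<and> unbounded_in r C (Field r) \<and>
     (\<forall>\<delta>\<in>Field r. underS r \<delta> \<noteq> {} \<and> unbounded_in r C (underS r \<delta>) \<longrightarrow> \<delta> \<in> C)"

definition n_subtle :: "nat \<Rightarrow> 'a rel \<Rightarrow> bool" where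
  "n_subtle n r \<longleftrightarrow>
     limit_ordinal r \<and>
     (\<forall>C S. closed_unbounded r C \<and>
        (\<forall>A. A \<subseteq> Field r \<and> card A = n \<longrightarrow> S A \<subseteq> underS r (wo_rel.minim r A)) \<longrightarrow>
        (\<exists>B. B \<subseteq> C \<and> card B = n + 1 \<and>
           (\<forall>A A'. A \<subseteq> B \<and> card A = n \<and> A' \<subseteq> B \<and> card A' = n \<longrightarrow>
              S A \<inter> underS r (wo_rel.minim r (A \<union> A')) =
              S A' \<inter> underS r (wo_rel.minim r (A \<union> A')))))"

section \<open>Downward directed lattice graphs\<close>

text \<open>
  \<open>N\<^sup>k\<close> is \<open>nlists k UNIV\<close> and \<open>E\<^sup>k\<close> is \<open>nlists k E\<close>; the maximum and minimum of the coordinates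
  of \<open>z\<close> are \<open>Max (set z)\<close> and \<open>Min (set z)\<close>.
\<close>

definition downward_lattice_graph :: "nat \<Rightarrow> nat list rel \<Rightarrow> bool" where
  "downward_lattice_graph k \<Theta> \<longleftrightarrow>
     \<Theta> \<subseteq> nlists k UNIV \<times> nlists k UNIV \<and> (\<forall>(x, y)\<in>\<Theta>. Max (set x) > Max (set y))"

definition induced_edges :: "'v rel \<Rightarrow> 'v set \<Rightarrow> 'v rel" where
  "induced_edges \<Theta> D = {(x, y) \<in> \<Theta>. x \<in> D \<and> y \<in> D}"

definition is_path :: "'v rel \<Rightarrow> 'v set \<Rightarrow> 'v list \<Rightarrow> bool" where
  "is_path \<Theta> D xs \<longleftrightarrow>
     xs \<noteq> [] \<and> distinct xs \<and> set xs \<subseteq> D \<and>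
     successively (\<lambda>x y. (x, y) \<in> induced_edges \<Theta> D) xs"

definition terminal_path :: "'v rel \<Rightarrow> 'v set \<Rightarrow> 'v list \<Rightarrow> bool" where
  "terminal_path \<Theta> D xs \<longleftrightarrow> is_path \<Theta> D xs \<and> \<not> (\<exists>y. is_path \<Theta> D (xs @ [y]))"

definition terminal_ends :: "'v rel \<Rightarrow> 'v set \<Rightarrow> 'v \<Rightarrow> 'v set" where
  "terminal_ends \<Theta> D z = {last xs | xs. terminal_path \<Theta> D xs \<and> hd xs = z}"

text \<open>The terminal path label function; only its values on \<open>D\<close> are meaningful.\<close>

definition t_hat :: "nat list rel \<Rightarrow> nat list set \<Rightarrow> nat list \<Rightarrow> nat" where
  "t_hat \<Theta> D z =
     (if terminal_path \<Theta> D [z] then Max (set z)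
      else Min {Min (set x) | x. x \<in> terminal_ends \<Theta> D z})"

text \<open>The family of all \<open>t_hat \<Theta> D\<close>, each function being paired with its domain \<open>D\<close>.\<close>

definition terminal_label_functions ::
    "nat \<Rightarrow> nat list rel \<Rightarrow> (nat list set \<times> (nat list \<Rightarrow> nat)) set" where
  "terminal_label_functions k \<Theta> = {(D, t_hat \<Theta> D) | D. D \<subseteq> nlists k UNIV \<and> finite D}"

section \<open>Regressive values and regressive regularity\<close>

definition regressive_values :: "(nat list \<Rightarrow> nat) \<Rightarrow> nat list set \<Rightarrow> nat set" where
  "regressive_values f X = {n. \<exists>x\<in>X. f x = n \<and> n < Min (set x)}"

text \<open>
  Two tuples of equal length have the same order type iff \<open>order_type\<close> agrees on them.
\<close>

definition order_type :: "nat list \<Rightarrow> (nat \<times> nat) set \<times> (nat \<times> nat) set" where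
  "order_type x =
     ({(i, j). i < length x \<and> j < length x \<and> x ! i < x ! j},
      {(i, j). i < length x \<and> j < length x \<and> x ! i = x ! j})"

definition regressively_regular :: "nat \<Rightarrow> (nat list \<Rightarrow> nat) \<Rightarrow> nat set \<Rightarrow> bool" where
  "regressively_regular k f E \<longleftrightarrow>
     (\<forall>ot \<in> order_type ` nlists k UNIV.
        (\<forall>x\<in>nlists k E. \<forall>y\<in>nlists k E.
           order_type x = ot \<and> order_type y = ot \<longrightarrow> f x = f y \<and> f y < Min E) \<or>
        (\<forall>x\<in>nlists k E. order_type x = ot \<longrightarrow> f x \<ge> Min (set x)))"

end

theory Submission
  imports Defs "HOL-Library.Ramsey" "HOL-Library.Product_Lexorder"
begin

text \<open>
  By Ramsey's theorem there is an infinite \<open>H\<close> on which membership of a pair of \<open>k\<close>-tuples in \<open>\<Theta>\<close>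
  depends only on their joint order pattern. The same patterns define a graph on the \<open>k\<close>-tuples over
  any linear order, here over \<open>\<omega>\<^sup>2\<close>, realised as pairs of naturals with the lexicographic order. Let
  \<open>z\<close> and \<open>z'\<close> be tuples of limit points \<open>(i, 0)\<close>, \<open>i > 0\<close>, of the same order type, and suppose that
  \<open>z\<close> reaches an end \<open>w\<close> with \<open>min w < min z\<close>. The finitely many values on the path can be moved so
  that \<open>z\<close> becomes \<open>z'\<close>, the values below \<open>min z\<close> become finite ordinals, and no gap of \<open>w\<close> grows; the
  image of \<open>w\<close> is therefore still an end, and its minimum has not increased. Hence the least minimum
  of an end below \<open>min z\<close> is a finite ordinal depending only on the order type of \<open>z\<close>. A finite
  subgraph that contains optimal paths and one successor of each of its non-ends yields the same labels below \<open>min z\<close>,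
  and is embedded into \<open>H\<close>.
\<close>

(* With these rules active, simplifying with nlists_def loops. *)
declare nlistsE_length [simp del] nlistsE_set [simp del]

section \<open>Order patterns\<close>

definition rank_in :: "'a::linorder set \<Rightarrow> 'a \<Rightarrow> nat" where
  "rank_in A a = card {b \<in> A. b < a}"

text \<open>A canonical code of an order pattern. It is a list of naturals whatever the order of the
  entries, so one set of codes can be used over several linear orders.\<close>

definition ranks :: "'a::linorder list \<Rightarrow> nat list" where
  "ranks xs = map (rank_in (set xs)) xs"

lemma strict_mono_on_rank_in: "finite A \<Longrightarrow> strict_mono_on A (rank_in A)"
  unfolding rank_in_def by (rule strict_mono_onI) (rule psubset_card_mono, auto)

lemma rank_in_less_card: "finite A \<Longrightarrow> a \<in> A \<Longrightarrow> rank_in A a < card A"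
  unfolding rank_in_def by (rule psubset_card_mono) auto

lemma ranks_map:
  fixes g :: "'a::linorder \<Rightarrow> 'b::linorder"
  assumes "strict_mono_on (set xs) g"
  shows "ranks (map g xs) = ranks xs"
proof -
  have "{b \<in> g ` set xs. b < g a} = g ` {b \<in> set xs. b < a}" if "a \<in> set xs" for a
    using that strict_mono_on_less[OF assms] by auto
  moreover have "inj_on g {b \<in> set xs. b < a}" for a
    by (rule inj_on_subset[OF strict_mono_on_imp_inj_on[OF assms]]) auto
  ultimately show ?thesis
    by (simp add: ranks_def rank_in_def card_image)
qed

lemma Min_image_strict_mono:
  fixes g :: "'a::linorder \<Rightarrow> 'b::linorder"
  assumes "strict_mono_on S g" "finite S" "S \<noteq> {}"
  shows "Min (g ` S) = g (Min S)"
  proof (rule Min_eqI)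
  show "g (Min S) \<in> g ` S"
    using assms by simp
  show "g (Min S) \<le> b" if "b \<in> g ` S" for b
    using that strict_mono_on_leD[OF assms(1) Min_in[OF assms(2,3)]] assms(2) by auto
qed (use assms(2) in simp)

lemma Max_image_strict_mono:
  fixes g :: "'a::linorder \<Rightarrow> 'b::linorder"
  assumes "strict_mono_on S g" "finite S" "S \<noteq> {}"
  shows "Max (g ` S) = g (Max S)"
  proof (rule Max_eqI)
  show "g (Max S) \<in> g ` S"
    using assms by simp
  show "b \<le> g (Max S)" if "b \<in> g ` S" for b
    using that strict_mono_on_leD[OF assms(1) _ Max_in[OF assms(2,3)]] assms(2) by auto
qed (use assms(2) in simp)

text \<open>The element of rank \<open>n\<close> goes to the \<open>n\<close>-th member of
  \<open>H\<close>. This carries finite configurations over any linear order into the homogeneous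
  set.\<close>

lemma obtain_embedding:
  fixes U :: "'a::linorder set" and H :: "nat set"
  assumes "finite U" "infinite H"
  obtains g where "strict_mono_on U g" "g ` U \<subseteq> H"
proof
  show "strict_mono_on U (\<lambda>u. enumerate H (rank_in U u))"
    using strict_mono_on_rank_in[OF assms(1)] assms(2)
    by (auto intro!: strict_mono_onI dest: strict_mono_onD)
  show "(\<lambda>u. enumerate H (rank_in U u)) ` U \<subseteq> H"
    using enumerate_in_set[OF assms(2)] by auto
qed

text \<open>A form of equality of order types for lists over two different linear orders; agreement
  of \<open><\<close> already forces agreement of equality.\<close>

definition same_order :: "'a::linorder list \<Rightarrow> 'b::linorder list \<Rightarrow> bool" where
  "same_order x y \<longleftrightarrow> length x = length y \<and>
     (\<forall>i<length x. \<forall>j<length x. x ! i < x ! j \<longleftrightarrow> y ! i < y ! j)"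

lemma same_order_sym: "same_order x y \<Longrightarrow> same_order y x"
  by (auto simp: same_order_def)

lemma same_order_eq_nth:
  assumes "same_order x y" "i < length x" "j < length x"
  shows "x ! i = x ! j \<longleftrightarrow> y ! i = y ! j"
  using assms unfolding same_order_def by (metis linorder_neq_iff)

lemma order_type_eqD:
  assumes "order_type x = order_type y" "length x = length y"
  shows "same_order x y"
  using assms unfolding same_order_def order_type_def by (auto simp: set_eq_iff)

lemma order_type_eqI:
  assumes "same_order x y"
  shows "order_type x = order_type y"
  using assms same_order_eq_nth[OF assms] unfolding order_type_def same_order_def by auto

lemma same_order_map:
  assumes "strict_mono_on (set x) g"
  shows "same_order x (map g x)"
  using strict_mono_on_less[OF assms] by (auto simp: same_order_def)

lemma same_order_trans: "same_order x y \<Longrightarrow> same_order y z \<Longrightarrow> same_order x z"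
  by (auto simp: same_order_def)

lemma same_order_ranks: "same_order x (ranks x)"
  unfolding ranks_def by (rule same_order_map) (simp add: strict_mono_on_rank_in)

lemma same_order_obtain:
  assumes "same_order x y"
  obtains g where "strict_mono_on (set x) g" "y = map g x"
proof
  \<comment> \<open>The index chosen is irrelevant: positions with equal entries in \<open>x\<close>
    have equal entries in \<open>y\<close>.\<close>
  define g where "g a = y ! (SOME i. i < length x \<and> x ! i = a)" for a
  have g: "g (x ! i) = y ! i" if "i < length x" for i
  proof -
    have "(SOME j. j < length x \<and> x ! j = x ! i) < length x
        \<and> x ! (SOME j. j < length x \<and> x ! j = x ! i) = x ! i"
      by (rule someI[of _ i]) (simp add: that)
    then show ?thesis
      unfolding g_def using same_order_eq_nth[OF assms] that by blast
  qed
  show "strict_mono_on (set x) g"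
    using assms g by (auto intro!: strict_mono_onI simp: in_set_conv_nth same_order_def)
  show "y = map g x"
    using assms g by (auto intro!: nth_equalityI simp: same_order_def)
qed

section \<open>Graphs given by order patterns\<close>

definition pattern_rel :: "nat \<Rightarrow> nat list set \<Rightarrow> 'a::linorder list rel" where
  "pattern_rel k T = {(x, y). length x = k \<and> length y = k \<and> ranks (x @ y) \<in> T}"

text \<open>The relation sees \<open>x\<close> and \<open>y\<close> only through their joint ranks,
  which an increasing map keeps. Source and target may be different orders, so edges can be moved
  between the lexicographic square and the naturals.\<close>

lemma pattern_rel_map:
  fixes g :: "'a::linorder \<Rightarrow> 'b::linorder"
  assumes "strict_mono_on (set x \<union> set y) g"
  shows "(map g x, map g y) \<in> pattern_rel k T \<longleftrightarrow> (x, y) \<in> pattern_rel k T"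
  using ranks_map[of "x @ y" g] assms by (simp add: pattern_rel_def)

lemma finite_nlists: "finite A \<Longrightarrow> finite (nlists n A)"
  using finite_lists_length_eq[of A n] by (simp add: nlists_def conj_commute)

text \<open>Two \<open>k\<close>-tuples have at most \<open>k + k\<close> distinct entries. Each set
  of size \<open>k + k\<close> is coloured by the codes of the edges over it; on a homogeneous
  \<open>H\<close> all these sets have the same codes, which form \<open>T\<close>.\<close>

lemma Ramsey_pattern_rel:
  fixes \<Theta> :: "nat list rel"
  obtains H T where "infinite H"
    "\<And>x y. x \<in> nlists k H \<Longrightarrow> y \<in> nlists k H \<Longrightarrow> (x, y) \<in> \<Theta> \<longleftrightarrow> (x, y) \<in> pattern_rel k T"
proof -
  define colour where "colour A = {map (rank_in A) (x @ y) | x y.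
      x \<in> nlists k A \<and> y \<in> nlists k A \<and> (x, y) \<in> \<Theta>}" for A
  define P where "P = Pow (nlists (k + k) {..<k + k})"
  have "finite P"
    by (simp add: P_def finite_nlists)
  then obtain h where h: "bij_betw h P {..<card P}"
    using ex_bij_betw_finite_nat[of P] by (auto simp: atLeast0LessThan)
  have col: "colour A \<in> P" if "finite A" "card A = k + k" for A
    using that rank_in_less_card[of A] unfolding colour_def P_def nlists_def by fastforce
  have "(h \<circ> colour) ` nsets UNIV (k + k) \<subseteq> {..<card P}"
    using col bij_betw_imp_surj_on[OF h] by (auto simp: nsets_def)
  from Ramsey_nsets[OF infinite_UNIV_nat this] obtain H t where H: "infinite H"
    and t: "(h \<circ> colour) ` nsets H (k + k) \<subseteq> {t}" .
  show thesis
  proof (rule that[OF H])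
    fix x y assume xy: "x \<in> nlists k H" "y \<in> nlists k H"
    define S where "S = set (x @ y)"
    have S: "finite S" "S \<subseteq> H"
      using xy by (auto simp: S_def nlists_def)
    have cS: "card S \<le> k + k"
      using card_length[of "x @ y"] xy by (simp add: S_def nlists_def)
    \<comment> \<open>The padding lies above all entries, so an entry has the same rank in
      \<open>A\<close> as in \<open>S\<close>. The inserted \<open>0\<close> keeps
      \<open>Max\<close> defined when \<open>S\<close> is empty.\<close>
    have "infinite (H - {..Max (insert 0 S)})"
      using H by simp
    then obtain B where B: "B \<subseteq> H - {..Max (insert 0 S)}" "finite B" "card B = k + k - card S"
      using infinite_arbitrarily_large[of _ "k + k - card S"] by metis
    have above: "a < b" if "a \<in> S" "b \<in> B" for a b
    proof -
      have "a \<le> Max (insert 0 S)" using that S by simp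
      moreover have "Max (insert 0 S) < b" using that B by auto
      ultimately show ?thesis by linarith
    qed
    define A where "A = S \<union> B"
    have "S \<inter> B = {}" using above by blast
    then have A: "finite A" "A \<subseteq> H" "card A = k + k"
      using S B cS by (auto simp: A_def card_Un_disjoint)
    have "{b \<in> A. b < a} = {b \<in> S. b < a}" if "a \<in> S" for a
      unfolding A_def using above[OF that] by (auto dest: less_asym)
    then have "rank_in A a = rank_in S a" if "a \<in> S" for a
      using that by (simp add: rank_in_def)
    then have rk: "map (rank_in A) (x @ y) = ranks (x @ y)"
      unfolding ranks_def S_def by simp
    have xyA: "x \<in> nlists k A" "y \<in> nlists k A"
      using xy by (auto simp: A_def S_def nlists_def)
    have inj: "inj_on (rank_in A) A"
      using strict_mono_on_rank_in[OF A(1)] by (rule strict_mono_on_imp_inj_on)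
    \<comment> \<open>Ranks in \<open>A\<close> are injective, so the code of \<open>(x, y)\<close>
      can be in the colour only on account of the pair \<open>(x, y)\<close> itself.\<close>
    have "(x, y) \<in> \<Theta> \<longleftrightarrow> map (rank_in A) (x @ y) \<in> colour A"
    proof
      assume "map (rank_in A) (x @ y) \<in> colour A"
      then obtain x' y' where xy': "x' \<in> nlists k A" "y' \<in> nlists k A" "(x', y') \<in> \<Theta>"
        and eq: "map (rank_in A) (x @ y) = map (rank_in A) (x' @ y')"
        unfolding colour_def by blast
      have "x @ y = x' @ y'"
        using eq
      proof (rule map_inj_on)
        show "inj_on (rank_in A) (set (x @ y) \<union> set (x' @ y'))"
          by (rule inj_on_subset[OF inj]) (use xyA xy' in \<open>simp add: nlists_def\<close>)
      qed
      then show "(x, y) \<in> \<Theta>"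
        using xyA xy' by (simp add: nlists_def)
    qed (use xyA in \<open>unfold colour_def, blast\<close>)
    moreover have "h (colour A) = t"
      using t A by (auto simp: nsets_def)
    then have "colour A = the_inv_into P h t"
      using the_inv_into_f_f[OF bij_betw_imp_inj_on[OF h] col[OF A(1,3)]] by simp
    ultimately show "(x, y) \<in> \<Theta> \<longleftrightarrow> (x, y) \<in> pattern_rel k (the_inv_into P h t)"
      using xy rk by (simp add: pattern_rel_def nlists_def)
  qed
qed

text \<open>An edge over any order is copied into \<open>H\<close>, where it is an edge of
  \<open>\<Theta>\<close>. The increasing copy commutes with \<open>Max\<close>, so the drop of the
  maximum is reflected back.\<close>

lemma pattern_rel_downward:
  fixes x y :: "'a::linorder list"
  assumes H: "infinite H"
    and HT: "\<And>x y. x \<in> nlists k H \<Longrightarrow> y \<in> nlists k H \<Longrightarrow> (x, y) \<in> \<Theta> \<longleftrightarrow> (x, y) \<in> pattern_rel k T"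
    and down: "downward_lattice_graph k \<Theta>" and "k > 0"
    and xy: "(x, y) \<in> pattern_rel k T"
  shows "Max (set y) < Max (set x)"
proof -
  obtain g where g: "strict_mono_on (set x \<union> set y) g" "g ` (set x \<union> set y) \<subseteq> H"
    using obtain_embedding[of "set x \<union> set y" H] H by auto
  have len: "length x = k" "length y = k"
    using xy by (auto simp: pattern_rel_def)
  then have ne: "set x \<noteq> {}" "set y \<noteq> {}"
    using \<open>k > 0\<close> by auto
  have gH: "map g x \<in> nlists k H" "map g y \<in> nlists k H"
    using g(2) len by (auto simp: nlists_def)
  have "(map g x, map g y) \<in> \<Theta>"
    using HT[THEN iffD2, OF gH] pattern_rel_map[OF g(1)] xy by blast
  then have "Max (g ` set y) < Max (g ` set x)"
    using down by (auto simp: downward_lattice_graph_def)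
  moreover have "strict_mono_on (set x) g" "strict_mono_on (set y) g"
    using g(1) by (auto intro: monotone_on_subset)
  ultimately have "g (Max (set y)) < g (Max (set x))"
    using ne by (simp add: Max_image_strict_mono)
  then show ?thesis
    using strict_mono_on_less[OF g(1), of "Max (set y)" "Max (set x)"] ne by simp
qed

section \<open>Ends of terminal paths\<close>

text \<open>The measure \<open>m\<close> falls along edges, so the last vertex minimises it on the
  path and none of its successors occurs there. Distinctness thus never blocks an extension.\<close>

lemma is_path_extend:
  fixes m :: "'v \<Rightarrow> nat"
  assumes down: "\<And>x y. (x, y) \<in> \<Theta> \<Longrightarrow> m y < m x"
    and path: "is_path \<Theta> D xs" and edge: "(last xs, y) \<in> induced_edges \<Theta> D"
  shows "is_path \<Theta> D (xs @ [y])"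
proof -
  have "m (last xs) \<le> m a"
    if "successively (\<lambda>x y. (x, y) \<in> induced_edges \<Theta> D) xs" "a \<in> set xs" for a
    using that
  proof (induction xs arbitrary: a)
    case (Cons b xs)
    show ?case
    proof (cases "xs = []")
      case False
      then have edge: "(b, hd xs) \<in> \<Theta>" and succ: "successively (\<lambda>x y. (x, y) \<in> induced_edges \<Theta> D) xs"
        using Cons.prems by (auto simp: successively_Cons induced_edges_def)
      have "m (last xs) \<le> m (hd xs)" "m (hd xs) < m b"
        using Cons.IH[OF succ, of "hd xs"] down[OF edge] False by simp_all
      then have "m (last xs) < m b"
        by (rule le_less_trans)
      then show ?thesis
        using Cons.IH[OF succ, of a] Cons.prems(2) by auto
    qed (use Cons.prems in simp)
  qed simp
  moreover have "m y < m (last xs)"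
    using edge down by (auto simp: induced_edges_def)
  ultimately have "y \<notin> set xs"
    using path unfolding is_path_def by (meson leD)
  then show ?thesis
    using path edge by (auto simp: is_path_def successively_append_iff induced_edges_def)
qed

text \<open>Only the lack of an edge can stop a path, so a path is terminal exactly when its last
  vertex has no successor. This replaces paths by reachability in all that follows.\<close>

lemma terminal_ends_downward:
  fixes m :: "'v \<Rightarrow> nat"
  assumes down: "\<And>x y. (x, y) \<in> \<Theta> \<Longrightarrow> m y < m x" and z: "z \<in> D"
  shows "terminal_ends \<Theta> D z =
    {w. (z, w) \<in> (induced_edges \<Theta> D)\<^sup>* \<and> w \<notin> Domain (induced_edges \<Theta> D)}"
proof -
  let ?I = "induced_edges \<Theta> D"
  note extend = is_path_extend[of \<Theta> m, OF down]
  have sound: "(hd xs, last xs) \<in> ?I\<^sup>*" if "is_path \<Theta> D xs" for xs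
  proof -
    have "successively (\<lambda>x y. (x, y) \<in> ?I) xs" "xs \<noteq> []"
      using that by (auto simp: is_path_def)
    then show ?thesis
    proof (induction xs)
      case (Cons x xs)
      then show ?case
        by (cases "xs = []") (auto simp: successively_Cons intro: converse_rtrancl_into_rtrancl)
    qed simp
  qed
  have complete: "\<exists>xs. is_path \<Theta> D xs \<and> hd xs = z \<and> last xs = w" if "(z, w) \<in> ?I\<^sup>*" for w
    using that
  proof induction
    case base
    show ?case
      using z by (intro exI[of _ "[z]"]) (simp add: is_path_def)
  next
    case (step w y)
    then obtain xs where xs: "is_path \<Theta> D xs" "hd xs = z" "last xs = w"
      by blast
    then have "is_path \<Theta> D (xs @ [y])"
      using extend[of D xs y] step.hyps(2) by simp
    moreover have "hd (xs @ [y]) = z"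
      using xs by (auto simp: is_path_def)
    ultimately show ?case
      by (metis last_snoc)
  qed
  have "(last xs, y) \<in> ?I" if "is_path \<Theta> D (xs @ [y])" "xs \<noteq> []" for xs y
    using that by (auto simp: is_path_def successively_append_iff)
  moreover have "xs \<noteq> []" if "is_path \<Theta> D xs" for xs
    using that by (simp add: is_path_def)
  ultimately have terminal: "terminal_path \<Theta> D xs \<longleftrightarrow> is_path \<Theta> D xs \<and> last xs \<notin> Domain ?I" for xs
    unfolding terminal_path_def using extend by blast
  show ?thesis
  proof (intro set_eqI iffI)
    fix w assume "w \<in> terminal_ends \<Theta> D z"
    then show "w \<in> {w. (z, w) \<in> ?I\<^sup>* \<and> w \<notin> Domain ?I}"
      unfolding terminal_ends_def terminal using sound by blast
  next
    fix w assume w: "w \<in> {w. (z, w) \<in> ?I\<^sup>* \<and> w \<notin> Domain ?I}"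
    then obtain xs where "is_path \<Theta> D xs" "hd xs = z" "last xs = w"
      using complete by blast
    then show "w \<in> terminal_ends \<Theta> D z"
      using w unfolding terminal_ends_def terminal by blast
  qed
qed

section \<open>Values of the label function at a vertex\<close>

context
  fixes k :: nat and \<Theta> :: "nat list rel" and D :: "nat list set" and z :: "nat list"
  assumes k: "k > 0" and down: "downward_lattice_graph k \<Theta>"
    and D: "finite D" "D \<subseteq> nlists k UNIV" and z: "z \<in> D"
begin

private abbreviation "I \<equiv> induced_edges \<Theta> D"

private lemma max_less: "(x, y) \<in> \<Theta> \<Longrightarrow> Max (set y) < Max (set x)"
  using down by (auto simp: downward_lattice_graph_def)

private lemma ends: "terminal_ends \<Theta> D z = {w. (z, w) \<in> I\<^sup>* \<and> w \<notin> Domain I}"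
  by (rule terminal_ends_downward[OF max_less z])

private lemma terminal_singleton: "terminal_path \<Theta> D [z] \<longleftrightarrow> z \<notin> Domain I"
proof -
  have "is_path \<Theta> D ([z] @ [y]) \<longleftrightarrow> (z, y) \<in> I" for y
    using z max_less[of z y] by (auto simp: is_path_def induced_edges_def)
  moreover have "is_path \<Theta> D [z]"
    using z by (simp add: is_path_def)
  ultimately show ?thesis
    unfolding terminal_path_def by blast
qed

private lemma finite_ends: "finite (terminal_ends \<Theta> D z)"
proof (rule finite_subset[OF _ D(1)])
  have "w \<in> D" if "(z, w) \<in> I\<^sup>*" for w
    using that
  proof cases
    case base
    then show ?thesis using z by simp
  next
    case step
    then show ?thesis by (simp add: induced_edges_def)
  qed
  then show "terminal_ends \<Theta> D z \<subseteq> D"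
    unfolding ends by blast
qed

text \<open>Walking along edges lowers the maximum and so must stop. Hence the minimum in
  \<open>t_hat\<close> is never taken over the empty set.\<close>

private lemma ends_nonempty: "terminal_ends \<Theta> D z \<noteq> {}"
proof -
  have "\<exists>w. (x, w) \<in> I\<^sup>* \<and> w \<notin> Domain I" for x
  proof (induction "Max (set x)" arbitrary: x rule: less_induct)
    case less
    show ?case
    proof (cases "x \<in> Domain I")
      case True
      then obtain y where y: "(x, y) \<in> I" by blast
      then have "Max (set y) < Max (set x)"
        using max_less[of x y] by (simp add: induced_edges_def)
      then obtain w where "(y, w) \<in> I\<^sup>*" "w \<notin> Domain I"
        using less by blast
      then show ?thesis
        using y by (blast intro: converse_rtrancl_into_rtrancl)
    qed blast
  qed
  then show ?thesis
    unfolding ends by blast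
qed

private lemma t_hat_nonterminal:
  "\<not> terminal_path \<Theta> D [z] \<Longrightarrow> t_hat \<Theta> D z = Min ((\<lambda>x. Min (set x)) ` terminal_ends \<Theta> D z)"
  by (simp only: t_hat_def if_False Setcompr_eq_image)

text \<open>If \<open>z\<close> has no successor, its label is its own maximum; otherwise the label
  is the minimum of some end, which the assumption bounds.\<close>

lemma t_hat_ge_Min:
  assumes "\<And>w. (z, w) \<in> I\<^sup>* \<Longrightarrow> w \<notin> Domain I \<Longrightarrow> Min (set z) \<le> Min (set w)"
  shows "Min (set z) \<le> t_hat \<Theta> D z"
proof (cases "terminal_path \<Theta> D [z]")
  case True
  have "set z \<noteq> {}"
    using subsetD[OF D(2) z] k by (auto simp: in_nlists_UNIV)
  then have "Min (set z) \<le> Max (set z)"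
    by (intro Max_ge Min_in) simp_all
  then show ?thesis
    using True by (simp add: t_hat_def)
next
  case False
  have "t_hat \<Theta> D z \<in> (\<lambda>x. Min (set x)) ` terminal_ends \<Theta> D z"
    unfolding t_hat_nonterminal[OF False]
    by (rule Min_in) (simp_all add: finite_ends ends_nonempty)
  then obtain w where "w \<in> terminal_ends \<Theta> D z" "t_hat \<Theta> D z = Min (set w)"
    by (rule imageE)
  then show ?thesis
    using assms[of w] by (simp add: ends)
qed

text \<open>An end of smaller minimum differs from \<open>z\<close>, so \<open>z\<close> has a
  successor and the second clause of \<open>t_hat\<close> applies, with \<open>w\<close> attaining
  the minimum.\<close>

lemma t_hat_eq_Min:
  assumes w: "(z, w) \<in> I\<^sup>*" "w \<notin> Domain I" and less: "Min (set w) < Min (set z)"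
    and least: "\<And>v. (z, v) \<in> I\<^sup>* \<Longrightarrow> v \<notin> Domain I \<Longrightarrow> Min (set w) \<le> Min (set v)"
  shows "t_hat \<Theta> D z = Min (set w)"
proof -
  have "z \<noteq> w"
    using less by blast
  with w(1) have "(z, w) \<in> I\<^sup>+"
    by (simp add: rtrancl_eq_or_trancl)
  then have "z \<in> Domain I"
    using trancl_domain[of I] by blast
  then have "t_hat \<Theta> D z = Min ((\<lambda>x. Min (set x)) ` terminal_ends \<Theta> D z)"
    by (simp only: t_hat_nonterminal terminal_singleton not_not)
  also have "\<dots> = Min (set w)"
  proof (rule Min_eqI)
    show "finite ((\<lambda>x. Min (set x)) ` terminal_ends \<Theta> D z)"
      using finite_ends by simp
    show "Min (set w) \<le> b" if "b \<in> (\<lambda>x. Min (set x)) ` terminal_ends \<Theta> D z" for b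
      using that least unfolding ends by blast
    show "Min (set w) \<in> (\<lambda>x. Min (set x)) ` terminal_ends \<Theta> D z"
      using w unfolding ends by blast
  qed
  finally show ?thesis .
qed

end

text \<open>A witness of a regressive value rules out the second alternative for its order type, so
  witnesses of the same type give the same value. Distinct values thus have witnesses with distinct
  rank lists, and these are among the \<open>k ^ k\<close> lists of length \<open>k\<close> over
  \<open>{..<k}\<close>.\<close>

lemma card_regressive_values_le:
  assumes "regressively_regular k f E"
  shows "card (regressive_values f (nlists k E)) \<le> k ^ k"
proof -
  define V where "V = regressive_values f (nlists k E)"
  have "\<exists>x. x \<in> nlists k E \<and> f x = n \<and> n < Min (set x)" if "n \<in> V" for n
    using that by (auto simp: V_def regressive_values_def)
  then obtain x where x: "\<And>n. n \<in> V \<Longrightarrow> x n \<in> nlists k E"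
      "\<And>n. n \<in> V \<Longrightarrow> f (x n) = n" "\<And>n. n \<in> V \<Longrightarrow> n < Min (set (x n))"
    by metis
  have len: "length (x n) = k" if "n \<in> V" for n
    using x(1)[OF that] by (simp add: nlists_def)
  have "inj_on (\<lambda>n. ranks (x n)) V"
  proof (rule inj_onI)
    fix n n' assume n: "n \<in> V" "n' \<in> V" and eq: "ranks (x n) = ranks (x n')"
    have "same_order (x n) (x n')"
      using same_order_ranks[of "x n"] same_order_ranks[of "x n'", THEN same_order_sym] eq
      by (metis same_order_trans)
    then have ot: "order_type (x n) = order_type (x n')"
      by (rule order_type_eqI)
    have "order_type (x n') \<in> order_type ` nlists k UNIV"
      using len[OF n(2)] by (auto simp: nlists_def)
    then have "(\<forall>u\<in>nlists k E. \<forall>v\<in>nlists k E. order_type u = order_type (x n') \<and>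
          order_type v = order_type (x n') \<longrightarrow> f u = f v) \<or>
        (\<forall>u\<in>nlists k E. order_type u = order_type (x n') \<longrightarrow> Min (set u) \<le> f u)"
      using assms unfolding regressively_regular_def by blast
    then show "n = n'"
      using x n ot by (metis leD)
  qed
  moreover have "(\<lambda>n. ranks (x n)) ` V \<subseteq> {xs. set xs \<subseteq> {..<k} \<and> length xs = k}"
  proof -
    have "rank_in (set (x n)) a < k" if "n \<in> V" "a \<in> set (x n)" for n a
      using rank_in_less_card[of "set (x n)" a] card_length[of "x n"] len that by simp
    then show ?thesis
      using len by (auto simp: ranks_def)
  qed
  moreover have "finite {xs. set xs \<subseteq> {..<k} \<and> length xs = k}"
    by (rule finite_lists_length_eq) simp
  ultimately have "card V \<le> card {xs. set xs \<subseteq> {..<k} \<and> length xs = k}"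
    by (rule card_inj_on_le)
  then show ?thesis
    by (simp add: V_def card_lists_length_eq)
qed

section \<open>Collapsing configurations in the lexicographic square of the natural numbers\<close>

text \<open>Collects the vertices of one walk. Finiteness later allows bounding the coordinates that
  occur and keeping only a finite subgraph.\<close>

lemma rtrancl_finite_subgraph:
  assumes "(x, y) \<in> R\<^sup>*"
  shows "\<exists>P. finite P \<and> P \<subseteq> R\<^sup>* `` {x} \<and> x \<in> P \<and> (x, y) \<in> (R \<inter> P \<times> P)\<^sup>*"
  using assms
proof induction
  case base
  show ?case by (rule exI[of _ "{x}"]) auto
next
  case (step y z)
  then obtain P where P: "finite P" "P \<subseteq> R\<^sup>* `` {x}" "x \<in> P" "(x, y) \<in> (R \<inter> P \<times> P)\<^sup>*"
    by blast
  have "(x, y) \<in> (R \<inter> insert y (insert z P) \<times> insert y (insert z P))\<^sup>*"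
    by (rule rev_subsetD[OF P(4)]) (rule rtrancl_mono, auto)
  then have "(x, z) \<in> (R \<inter> insert y (insert z P) \<times> insert y (insert z P))\<^sup>*"
    using step by (auto intro: rtrancl_into_rtrancl)
  then show ?case
    using P step by (intro exI[of _ "insert y (insert z P)"]) (auto intro: rtrancl_into_rtrancl)
qed

lemma pattern_rel_rtrancl_map:
  assumes "(x, y) \<in> (pattern_rel k T \<inter> P \<times> P)\<^sup>*"
    and g: "strict_mono_on V g" and P: "\<And>x. x \<in> P \<Longrightarrow> set x \<subseteq> V"
  shows "(map g x, map g y) \<in> (pattern_rel k T)\<^sup>*"
  using assms(1)
proof induction
  case (step y z)
  have "strict_mono_on (set y \<union> set z) g"
    by (rule monotone_on_subset[OF g]) (use P step in blast)
  then have "(map g y, map g z) \<in> pattern_rel k T"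
    using step pattern_rel_map by blast
  then show ?case
    using step by (meson rtrancl_into_rtrancl)
qed auto

lemma pattern_rel_rtrancl_length:
  assumes "(x, y) \<in> (pattern_rel k T)\<^sup>*" "length x = k"
  shows "length y = k"
  using assms by induction (auto simp: pattern_rel_def)

text \<open>
  In the image of a map that preserves the finite gaps of \<open>W\<close>, every gap is at most as large as
  the corresponding gap of \<open>W\<close>, so additional points can be moved back.
\<close>

lemma obtain_expansion:
  fixes W S :: "(nat \<times> nat) set" and \<psi> :: "nat \<times> nat \<Rightarrow> nat \<times> nat"
  assumes W: "finite W" "(0, 0) \<in> W" and S: "finite S"
    and mono: "strict_mono_on W \<psi>" and zero: "\<psi> (0, 0) = (0, 0)"
    and gaps: "\<And>c n n'. (c, n) \<in> W \<Longrightarrow> (c, n') \<in> W \<Longrightarrow> n \<le> n' \<Longrightarrow>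
      \<psi> (c, n') = (fst (\<psi> (c, n)), snd (\<psi> (c, n)) + (n' - n))"
  obtains \<theta> where "strict_mono_on S \<theta>" "\<And>a. a \<in> W \<Longrightarrow> \<theta> (\<psi> a) = a"
proof
  \<comment> \<open>\<open>A d\<close> is the last point of \<open>W\<close> whose image is not
    above \<open>d\<close>. The map \<open>\<theta>\<close> puts \<open>d\<close> as many steps
    after \<open>A d\<close> as there are points of \<open>S\<close> after
    \<open>\<psi> (A d)\<close> and up to \<open>d\<close>.\<close>
  define A where "A d = Max {a \<in> W. \<psi> a \<le> d}" for d
  define \<theta> where "\<theta> d = (fst (A d), snd (A d) + card {e \<in> S. \<psi> (A d) < e \<and> e \<le> d})" for d
  have "A d \<in> {a \<in> W. \<psi> a \<le> d}" for d
    unfolding A_def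
  proof (rule Max_in)
    have "(0, 0) \<in> {a \<in> W. \<psi> a \<le> d}"
      using W zero by (cases d) auto
    then show "{a \<in> W. \<psi> a \<le> d} \<noteq> {}" by blast
  qed (use W in simp)
  then have A: "A d \<in> W" "\<psi> (A d) \<le> d" for d
    by auto
  have A_ge: "a \<le> A d" if "a \<in> W" "\<psi> a \<le> d" for a d
    using that W by (simp add: A_def)
  show "\<theta> (\<psi> a) = a" if "a \<in> W" for a
  proof -
    have "A (\<psi> a) = a"
      using A[of "\<psi> a"] A_ge[OF that, of "\<psi> a"] strict_mono_on_less_eq[OF mono, of "A (\<psi> a)" a] that
      by (simp add: antisym)
    moreover have "{e \<in> S. \<psi> a < e \<and> e \<le> \<psi> a} = {}"
      by (auto dest: leD)
    ultimately show ?thesis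
      by (simp add: \<theta>_def del: Collect_empty_eq)
  qed
  show "strict_mono_on S \<theta>"
  proof (rule strict_mono_onI)
    fix d d' assume d: "d \<in> S" "d' \<in> S" "d < d'"
    have "\<psi> (A d) \<le> d'"
      using A[of d] d by (meson less_imp_le order_trans)
    then have le: "A d \<le> A d'"
      using A A_ge by blast
    show "\<theta> d < \<theta> d'"
    proof (cases "A d = A d'")
      case True
      have "{e \<in> S. \<psi> (A d) < e \<and> e \<le> d} \<subset> {e \<in> S. \<psi> (A d) < e \<and> e \<le> d'}"
        using d A[of d] by (auto dest: less_imp_le order_trans leD intro: le_less_trans)
      then have "card {e \<in> S. \<psi> (A d) < e \<and> e \<le> d} < card {e \<in> S. \<psi> (A d) < e \<and> e \<le> d'}"
        by (rule psubset_card_mono[rotated]) (use S in simp)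
      then show ?thesis
        using True by (simp add: \<theta>_def)
    next
      case False
      with le have less: "A d < A d'" by simp
      show ?thesis
      proof (cases "fst (A d) < fst (A d')")
        case False
        obtain c n n' where cn: "A d = (c, n)" "A d' = (c, n')" "n < n'"
          using False less by (cases "A d"; cases "A d'") auto
        obtain s t where st: "\<psi> (c, n) = (s, t)"
          by (cases "\<psi> (c, n)")
        have "\<not> \<psi> (A d') \<le> d"
          using A_ge[OF A(1), of d' d] less by auto
        moreover have "\<psi> (A d') = (s, t + (n' - n))"
          using gaps[of c n n'] A(1)[of d] A(1)[of d'] cn st by simp
        ultimately have "d < (s, t + (n' - n))"
          by simp
        \<comment> \<open>The points counted lie strictly between two images at distance
          \<open>n' - n\<close>, so there are fewer than \<open>n' - n\<close> of them and
          \<open>\<theta> d\<close> stays before \<open>A d'\<close>.\<close>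
        then have "{e \<in> S. \<psi> (A d) < e \<and> e \<le> d} \<subseteq> Pair s ` {t<..<t + (n' - n)}"
          using cn st by (cases d) auto
        then have "card {e \<in> S. \<psi> (A d) < e \<and> e \<le> d} \<le> card (Pair s ` {t<..<t + (n' - n)})"
          by (rule card_mono[rotated]) simp
        also have "\<dots> < n' - n"
          using cn(3) by (simp add: card_image inj_on_def)
        finally show ?thesis
          using cn by (simp add: \<theta>_def)
      qed (simp add: \<theta>_def)
    qed
  qed
qed

text \<open>Call the points with first coordinate \<open>c\<close> row \<open>c\<close>. The rows
  from one entry of \<open>z\<close> up to the next are packed into the row of the corresponding
  entry of \<open>z'\<close>, and the rows below all entries into row \<open>0\<close>. Distances
  within a row are kept, and infinite gaps inside a packed block become finite, so an end stays an
  end.\<close>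

lemma collapse_end:
  fixes z z' w :: "(nat \<times> nat) list"
  assumes z: "\<And>a. a \<in> set z \<Longrightarrow> 0 < fst a \<and> snd a = 0"
    and z': "\<And>a. a \<in> set z' \<Longrightarrow> 0 < fst a \<and> snd a = 0"
    and ord: "same_order z z'" and len: "length z = k" "k > 0"
    and reach: "(z, w) \<in> (pattern_rel k T)\<^sup>*" and end_w: "w \<notin> Domain (pattern_rel k T)"
    and low: "Min (set w) < Min (set z)"
  shows "\<exists>w'. (z', w') \<in> (pattern_rel k T)\<^sup>* \<and> w' \<notin> Domain (pattern_rel k T) \<and>
    Min (set w') \<le> Min (set w) \<and> Min (set w') < (1, 0)"
proof -
  let ?R = "pattern_rel k T :: (nat \<times> nat) list rel"
  obtain g where g: "strict_mono_on (set z) g" "z' = map g z"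
    using same_order_obtain[OF ord] .
  \<comment> \<open>The action of \<open>g\<close> on row indices; row \<open>0\<close>, which
    contains no entry of \<open>z\<close>, stays fixed.\<close>
  define \<sigma> where "\<sigma> i = (if i = 0 then 0 else fst (g (i, 0)))" for i
  define I where "I = insert 0 (fst ` set z)"
  have finI: "finite I"
    by (simp add: I_def)
  have inI: "(i, 0) \<in> set z" if "i \<in> I" "i > 0" for i
    using that z unfolding I_def by (metis imageE insertE less_irrefl prod.collapse)
  have gz: "0 < fst (g a) \<and> snd (g a) = 0" if "a \<in> set z" for a
    using z' g that by simp
  have \<sigma>: "\<sigma> i < \<sigma> j" if "i \<in> I" "j \<in> I" "i < j" for i j
  proof (cases "i = 0")
    case True
    then show ?thesis
      using gz inI that by (simp add: \<sigma>_def)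
  next
    case False
    then have "g (i, 0) < g (j, 0)"
      using inI that by (intro strict_mono_onD[OF g(1)]) auto
    then show ?thesis
      using gz[of "(i, 0)"] gz[of "(j, 0)"] inI that False
      by (cases "g (i, 0)"; cases "g (j, 0)") (auto simp: \<sigma>_def)
  qed
  obtain P where P: "finite P" "z \<in> P" "(z, w) \<in> (?R \<inter> P \<times> P)\<^sup>*"
    using rtrancl_finite_subgraph[OF reach] by blast
  have "w \<in> P"
    using P(3,2) by induction auto
  define V where "V = insert (0, 0) (\<Union>(set ` P))"
  have finV: "finite V"
    using P by (simp add: V_def)
  have PV: "set x \<subseteq> V" if "x \<in> P" for x
    using that by (auto simp: V_def)
  \<comment> \<open>A bound above all second coordinates in play: rows packed into one row at
    distance \<open>M\<close> do not overlap.\<close>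
  define M where "M = Suc (Max (snd ` V))"
  have M: "n < M" if "(c, n) \<in> V" for c n
    using that finV by (force simp: M_def less_Suc_eq_le intro: Max_ge)
  \<comment> \<open>The first row of the block containing row \<open>c\<close>; it exists because
    \<open>0\<close> is in \<open>I\<close>.\<close>
  define base where "base c = Max {i \<in> I. i \<le> c}" for c
  have "base c \<in> {i \<in> I. i \<le> c}" for c
    unfolding base_def by (rule Max_in) (use finI in \<open>auto simp: I_def\<close>)
  then have base: "base c \<in> I" "base c \<le> c" for c
    by auto
  have base_ge: "i \<le> base c" if "i \<in> I" "i \<le> c" for i c
    using that finI by (simp add: base_def)
  define \<psi> where "\<psi> a = (\<sigma> (base (fst a)), (fst a - base (fst a)) * M + snd a)" for a
  have \<psi>_mono: "strict_mono_on V \<psi>"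
  proof (rule strict_mono_onI)
    fix a a' assume a: "a \<in> V" "a' \<in> V" "a < a'"
    obtain c n c' n' where eq: "a = (c, n)" "a' = (c', n')"
      by (cases a; cases a')
    show "\<psi> a < \<psi> a'"
    proof (cases "c < c'")
      case True
      have le: "base c \<le> base c'"
        using base[of c] True by (intro base_ge) auto
      show ?thesis
      proof (cases "base c = base c'")
        case b: True
        have "(c - base c) * M + n < Suc (c - base c) * M"
          using M a eq by simp
        also have "\<dots> \<le> (c' - base c) * M"
          using True base[of c] by (intro mult_right_mono) auto
        finally show ?thesis
          using b by (simp add: \<psi>_def eq)
      next
        case False
        then show ?thesis
          using \<sigma>[of "base c" "base c'"] base le by (simp add: \<psi>_def eq)
      qed
    next
      case False
      then show ?thesis
        using a eq by (simp add: \<psi>_def)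
    qed
  qed
  have "\<psi> a = g a" if a: "a \<in> set z" for a
  proof -
    obtain i where i: "a = (i, 0)" "i > 0"
      using z[OF a] by (cases a) auto
    have "i \<in> I"
      using a i by (force simp: I_def)
    then have "base i = i"
      using base[of i] base_ge[of i i] by simp
    then show ?thesis
      using i gz[OF a] by (intro prod_eqI) (simp_all add: \<psi>_def \<sigma>_def)
  qed
  then have \<psi>_z: "map \<psi> z = z'"
    using g by simp
  have reach': "(z', map \<psi> w) \<in> ?R\<^sup>*"
    using pattern_rel_rtrancl_map[OF P(3) \<psi>_mono PV] \<psi>_z by simp
  have base0: "base 0 = 0"
    using base[of 0] by simp
  have end_w': "map \<psi> w \<notin> Domain ?R"
  proof
    assume "map \<psi> w \<in> Domain ?R"
    then obtain v where v: "(map \<psi> w, v) \<in> ?R" by blast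
    have sub: "insert (0, 0) (set w) \<subseteq> V"
      using PV[OF \<open>w \<in> P\<close>] by (auto simp: V_def)
    have mono: "strict_mono_on (insert (0, 0) (set w)) \<psi>"
      by (rule monotone_on_subset[OF \<psi>_mono sub])
    have zero: "\<psi> (0, 0) = (0, 0)"
      by (simp add: \<psi>_def base0 \<sigma>_def)
    have gaps: "\<psi> (c, n') = (fst (\<psi> (c, n)), snd (\<psi> (c, n)) + (n' - n))" if "n \<le> n'" for c n n'
      using that by (simp add: \<psi>_def)
    \<comment> \<open>Expansion carries the supposed edge to \<open>v\<close> back to an edge
      leaving \<open>w\<close>. The point \<open>(0, 0)\<close> is an anchor for entries of
      \<open>v\<close> below the whole image of \<open>w\<close>.\<close>
    obtain \<theta> where \<theta>: "strict_mono_on (set (map \<psi> w) \<union> set v) \<theta>"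
        "\<And>a. a \<in> insert (0, 0) (set w) \<Longrightarrow> \<theta> (\<psi> a) = a"
      using obtain_expansion[OF _ _ _ mono zero gaps, of "set (map \<psi> w) \<union> set v"] by auto
    have "(map \<theta> (map \<psi> w), map \<theta> v) \<in> ?R"
      using pattern_rel_map[OF \<theta>(1)] v by blast
    moreover have "map \<theta> (map \<psi> w) = w"
      using \<theta>(2) by (simp add: map_idI)
    ultimately show False
      using end_w by auto
  qed
  have "length w = k"
    by (rule pattern_rel_rtrancl_length[OF reach len(1)])
  then have ne: "set w \<noteq> {}" "set z \<noteq> {}"
    using len by auto
  have "Min (set (map \<psi> w)) = \<psi> (Min (set w))"
    using Min_image_strict_mono[OF monotone_on_subset[OF \<psi>_mono PV[OF \<open>w \<in> P\<close>]]] ne by simp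
  moreover obtain c n where cn: "Min (set w) = (c, n)"
    by (cases "Min (set w)")
  \<comment> \<open>The minimum of \<open>w\<close> precedes every entry of \<open>z\<close>, so its
    row is packed into row \<open>0\<close>; its image \<open>(0, c * M + n)\<close> is a finite
    ordinal and not above \<open>(c, n)\<close>.\<close>
  moreover have "base c = 0"
  proof (rule ccontr)
    assume "base c \<noteq> 0"
    then have "(base c, 0) \<in> set z"
      using inI base by simp
    then have "(c, n) < (base c, 0)"
      using low cn by (metis List.finite_set Min_le less_le_trans)
    then show False
      using base[of c] by simp
  qed
  ultimately have Min_w': "Min (set (map \<psi> w)) = (0, c * M + n)"
    by (simp add: \<psi>_def \<sigma>_def)
  then have "Min (set (map \<psi> w)) \<le> Min (set w)" "Min (set (map \<psi> w)) < (1, 0)"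
    using cn by auto
  then show ?thesis
    using reach' end_w' by blast
qed

section \<open>Transfer to the integers\<close>

text \<open>Repeatedly choosing a successor stops at an end, since \<open>m\<close> decreases in a
  wellorder. Adding such a chain at every vertex of the given walks yields a finite \<open>D\<close>
  in which only ends of \<open>R\<close> lack a successor.\<close>

lemma finite_closed_subgraph:
  fixes R :: "'v rel" and m :: "'v \<Rightarrow> 'm::wellorder"
  assumes down: "\<And>x y. (x, y) \<in> R \<Longrightarrow> m y < m x"
    and Q: "finite Q" "Q \<subseteq> R\<^sup>*"
  obtains D where "finite D" "D \<subseteq> R\<^sup>* `` fst ` Q" "fst ` Q \<subseteq> D"
    "\<And>x. x \<in> D \<Longrightarrow> x \<in> Domain R \<Longrightarrow> \<exists>y\<in>D. (x, y) \<in> R"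
    "Q \<subseteq> (R \<inter> D \<times> D)\<^sup>*"
proof -
  have chain: "\<exists>C. finite C \<and> C \<subseteq> R\<^sup>* `` {x} \<and> x \<in> C \<and> (\<forall>a\<in>C. a \<in> Domain R \<longrightarrow> (\<exists>y\<in>C. (a, y) \<in> R))" for x
  proof (induction "m x" arbitrary: x rule: less_induct)
    case less
    show ?case
    proof (cases "x \<in> Domain R")
      case True
      then obtain y where y: "(x, y) \<in> R" by blast
      obtain C where C: "finite C" "C \<subseteq> R\<^sup>* `` {y}" "y \<in> C"
          "\<forall>a\<in>C. a \<in> Domain R \<longrightarrow> (\<exists>y\<in>C. (a, y) \<in> R)"
        using less[OF down[OF y]] by blast
      have "insert x C \<subseteq> R\<^sup>* `` {x}"
        using C(2) y by (blast intro: converse_rtrancl_into_rtrancl)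
      then show ?thesis
        using C y by (intro exI[of _ "insert x C"]) blast
    next
      case False
      then show ?thesis
        by (intro exI[of _ "{x}"]) blast
    qed
  qed
  then obtain C where C: "\<And>x. finite (C x)" "\<And>x. C x \<subseteq> R\<^sup>* `` {x}" "\<And>x. x \<in> C x"
      "\<And>x a. a \<in> C x \<Longrightarrow> a \<in> Domain R \<Longrightarrow> \<exists>y\<in>C x. (a, y) \<in> R"
    by metis
  have "\<exists>P. finite P \<and> P \<subseteq> R\<^sup>* `` {fst q} \<and> fst q \<in> P \<and> q \<in> (R \<inter> P \<times> P)\<^sup>*" if "q \<in> Q" for q
    using rtrancl_finite_subgraph[of "fst q" "snd q" R] subsetD[OF Q(2) that] by simp
  then obtain P where P: "\<And>q. q \<in> Q \<Longrightarrow> finite (P q)" "\<And>q. q \<in> Q \<Longrightarrow> P q \<subseteq> R\<^sup>* `` {fst q}"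
      "\<And>q. q \<in> Q \<Longrightarrow> fst q \<in> P q" "\<And>q. q \<in> Q \<Longrightarrow> q \<in> (R \<inter> P q \<times> P q)\<^sup>*"
    by metis
  define D where "D = (\<Union>q\<in>Q. \<Union>x\<in>P q. C x)"
  have PD: "P q \<subseteq> D" if "q \<in> Q" for q
    using that C(3) by (auto simp: D_def)
  show thesis
  proof
    show "finite D"
      using Q C(1) P(1) by (simp add: D_def)
    show "D \<subseteq> R\<^sup>* `` fst ` Q"
    proof
      fix a assume "a \<in> D"
      then obtain q x where qx: "q \<in> Q" "x \<in> P q" "a \<in> C x"
        by (auto simp: D_def)
      then have "(fst q, x) \<in> R\<^sup>*" "(x, a) \<in> R\<^sup>*"
        using P(2) C(2) by blast+
      then show "a \<in> R\<^sup>* `` fst ` Q"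
        using qx(1) by (meson ImageI imageI rtrancl_trans)
    qed
    show "fst ` Q \<subseteq> D"
      using P(3) PD by blast
    show "\<exists>y\<in>D. (x, y) \<in> R" if x: "x \<in> D" "x \<in> Domain R" for x
    proof -
      obtain q u where qu: "q \<in> Q" "u \<in> P q" "x \<in> C u"
        using x(1) unfolding D_def by blast
      then obtain y where "y \<in> C u" "(x, y) \<in> R"
        using C(4) x(2) by blast
      then show ?thesis
        using qu by (auto simp: D_def)
    qed
    show "Q \<subseteq> (R \<inter> D \<times> D)\<^sup>*"
    proof
      fix q assume q: "q \<in> Q"
      have "R \<inter> P q \<times> P q \<subseteq> R \<inter> D \<times> D"
        using PD[OF q] by blast
      then show "q \<in> (R \<inter> D \<times> D)\<^sup>*"
        using P(4)[OF q] rtrancl_mono by blast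
    qed
  qed
qed

text \<open>For each order type, either some tuple of limit points reaches an end of smaller
  minimum, and then all do with the same least minimum, or none does. These cases give the two
  alternatives of regressive regularity.\<close>

lemma exists_regressively_regular:
  assumes k: "k > 0" and p: "p > 0" and down: "downward_lattice_graph k \<Theta>"
  shows "\<exists>D E. finite D \<and> D \<subseteq> nlists k UNIV \<and> card E = p \<and> nlists k E \<subseteq> D \<and>
    regressively_regular k (t_hat \<Theta> D) E"
proof -
  obtain H T where H: "infinite H" and HT: "\<And>x y. x \<in> nlists k H \<Longrightarrow> y \<in> nlists k H \<Longrightarrow>
      (x, y) \<in> \<Theta> \<longleftrightarrow> (x, y) \<in> pattern_rel k T"
    using Ramsey_pattern_rel[of k \<Theta>] by metis
  let ?R = "pattern_rel k T :: (nat \<times> nat) list rel"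
  have R_down: "Max (set y) < Max (set x)" if "(x, y) \<in> ?R" for x y
    using pattern_rel_downward[OF H HT down k that] .
  \<comment> \<open>Row \<open>0\<close> is left out, so the finite ordinals lie below every point
    of \<open>F\<close>, and \<open>(1, 0)\<close> is its first point.\<close>
  define F where "F = (\<lambda>i. (i, 0::nat)) ` {1..p}"
  define Z where "Z = nlists k F"
  have F: "finite F" "card F = p" "(1, 0) \<in> F"
    using p by (auto simp: F_def card_image inj_on_def)
  have F_pos: "0 < fst a \<and> snd a = 0" if "a \<in> F" for a
    using that by (auto simp: F_def)
  have Z: "length z = k" "set z \<subseteq> F" if "z \<in> Z" for z
    using that by (simp_all add: Z_def nlists_def)
  have finZ: "finite Z"
    unfolding Z_def by (rule finite_nlists[OF F(1)])

  \<comment> \<open>Ends of smaller minimum\<close>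
  define low where "low z w \<longleftrightarrow> (z, w) \<in> ?R\<^sup>* \<and> w \<notin> Domain ?R \<and> Min (set w) < Min (set z)" for z w
  define least where "least z = (LEAST a. \<exists>w. low z w \<and> Min (set w) = a)" for z
  have least_le: "least z \<le> Min (set w)" if "low z w" for z w
    unfolding least_def by (rule Least_le) (use that in blast)
  have least_ex: "\<exists>w. low z w \<and> Min (set w) = least z" if "\<exists>w. low z w" for z
    unfolding least_def by (rule LeastI_ex) (use that in blast)
  have F_min: "(1, 0) \<le> Min (set z)" if "z \<in> Z" for z
  proof -
    have "Min (set z) \<in> set z"
      using Z(1)[OF that] k by (intro Min_in) auto
    then have "Min (set z) \<in> F"
      using Z(2)[OF that] by blast
    then show ?thesis
      using F_pos[of "Min (set z)"] by (cases "Min (set z)") auto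
  qed
  have same: "\<exists>w'. low z' w' \<and> Min (set w') \<le> Min (set w) \<and> Min (set w') < (1, 0)"
    if z: "z \<in> Z" "z' \<in> Z" "same_order z z'" "low z w" for z z' w
  proof -
    have zw: "(z, w) \<in> ?R\<^sup>*" "w \<notin> Domain ?R" "Min (set w) < Min (set z)"
      using z(4) by (simp_all add: low_def)
    obtain w' where w': "(z', w') \<in> ?R\<^sup>*" "w' \<notin> Domain ?R"
        "Min (set w') \<le> Min (set w)" "Min (set w') < (1, 0)"
      using collapse_end[OF _ _ z(3) Z(1)[OF z(1)] k zw] Z(2)[OF z(1)] Z(2)[OF z(2)] F_pos by blast
    moreover have "Min (set w') < Min (set z')"
      using w'(4) F_min[OF z(2)] by (rule less_le_trans)
    ultimately show ?thesis
      unfolding low_def by blast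
  qed
  have least_same: "(\<exists>w. low z' w) \<and> least z' = least z \<and> least z < (1, 0)"
    if zz: "z \<in> Z" "z' \<in> Z" "same_order z z'" and ex: "\<exists>w. low z w" for z z'
  proof -
    \<comment> \<open>Collapsing a best end for \<open>u\<close> gives an end for \<open>v\<close>
      that is no worse. Applied in both directions, this yields equality.\<close>
    have le: "(\<exists>w. low v w) \<and> least v \<le> least u \<and> least v < (1, 0)"
      if uv: "u \<in> Z" "v \<in> Z" "same_order u v" and ex: "\<exists>w. low u w" for u v
    proof -
      obtain w where "low u w" "Min (set w) = least u"
        using least_ex[OF ex] by blast
      then obtain w' where w': "low v w'" "Min (set w') \<le> least u" "Min (set w') < (1, 0)"
        using same[OF uv] by metis
      show ?thesis
        using w' least_le[OF w'(1)] by (meson le_less_trans order_trans)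
    qed
    have "(\<exists>w. low z' w) \<and> least z' \<le> least z \<and> least z' < (1, 0)"
      using le zz ex by blast
    moreover from this have "least z \<le> least z'"
      using le[of z' z] zz same_order_sym by blast
    ultimately show ?thesis
      by auto
  qed
  \<comment> \<open>\<open>W z\<close> is an optimal end where an end of smaller minimum exists;
    elsewhere any reachable vertex serves as a default.\<close>
  have "\<exists>w. (z, w) \<in> ?R\<^sup>* \<and> ((\<exists>v. low z v) \<longrightarrow> low z w \<and> Min (set w) = least z)" for z
  proof (cases "\<exists>v. low z v")
    case True
    then show ?thesis
      using least_ex low_def by blast
  qed blast
  then obtain W where W: "\<And>z. (z, W z) \<in> ?R\<^sup>*"
      "\<And>z. \<exists>v. low z v \<Longrightarrow> low z (W z) \<and> Min (set (W z)) = least z"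
    by metis
  define Q where "Q = (\<lambda>z. (z, W z)) ` Z"
  have fstQ: "fst ` Q = Z"
    by (simp add: Q_def image_image)
  obtain D where D: "finite D" "D \<subseteq> ?R\<^sup>* `` Z" "Z \<subseteq> D"
      "\<And>x. x \<in> D \<Longrightarrow> x \<in> Domain ?R \<Longrightarrow> \<exists>y\<in>D. (x, y) \<in> ?R"
      "Q \<subseteq> (?R \<inter> D \<times> D)\<^sup>*"
  proof (rule finite_closed_subgraph[of ?R "\<lambda>x. Max (set x)" Q])
    show "finite Q" "Q \<subseteq> ?R\<^sup>*"
      using finZ W(1) by (auto simp: Q_def)
  qed (use R_down in \<open>auto simp: fstQ\<close>)
  have lenD: "length x = k" if "x \<in> D" for x
    using that D(2) pattern_rel_rtrancl_length Z(1) by blast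

  \<comment> \<open>Embedding the finite subgraph into the naturals\<close>
  define U where "U = F \<union> \<Union>(set ` D)"
  have "finite U"
    using D(1) F(1) by (simp add: U_def)
  then obtain g where g: "strict_mono_on U g" "g ` U \<subseteq> H"
    using obtain_embedding H by metis
  have inj: "inj_on g U"
    by (rule strict_mono_on_imp_inj_on[OF g(1)])
  have DU: "set x \<subseteq> U" if "x \<in> D" for x
    using that by (auto simp: U_def)
  have FU: "F \<subseteq> U"
    by (simp add: U_def)
  have ne: "set x \<noteq> {}" if "x \<in> D" for x
    using lenD[OF that] k by auto
  have Min_g: "Min (set (map g x)) = g (Min (set x))" if "x \<in> D" for x
    using Min_image_strict_mono[OF monotone_on_subset[OF g(1) DU[OF that]]] ne[OF that] by simp
  have Min_U: "Min (set x) \<in> U" if "x \<in> D" for x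
    using Min_in[OF _ ne[OF that]] DU[OF that] by auto
  define D' where "D' = map g ` D"
  let ?I = "induced_edges \<Theta> D'"
  have gH: "map g x \<in> nlists k H" if "x \<in> D" for x
    using lenD[OF that] DU[OF that] g(2) by (auto simp: nlists_def)
  have edge: "(map g x, map g y) \<in> ?I \<longleftrightarrow> (x, y) \<in> ?R" if "x \<in> D" "y \<in> D" for x y
  proof -
    have "(map g x, map g y) \<in> \<Theta> \<longleftrightarrow> (map g x, map g y) \<in> pattern_rel k T"
      using HT gH that by blast
    also have "\<dots> \<longleftrightarrow> (x, y) \<in> ?R"
      using DU that by (intro pattern_rel_map monotone_on_subset[OF g(1)]) auto
    finally show ?thesis
      using that by (simp add: induced_edges_def D'_def)
  qed
  \<comment> \<open>The embedded subgraph has no false ends, because \<open>D\<close> keeps a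
    successor of each of its non-ends.\<close>
  have end_iff: "map g x \<in> Domain ?I \<longleftrightarrow> x \<in> Domain ?R" if x: "x \<in> D" for x
  proof
    assume "map g x \<in> Domain ?I"
    then obtain v where v: "(map g x, v) \<in> ?I" by blast
    then obtain y where "y \<in> D" "v = map g y"
      by (auto simp: induced_edges_def D'_def)
    then show "x \<in> Domain ?R"
      using edge[OF x] v by blast
  next
    assume "x \<in> Domain ?R"
    then show "map g x \<in> Domain ?I"
      using D(4)[OF x] edge[OF x] by blast
  qed
  have down_path: "\<exists>w\<in>D. v = map g w \<and> (z, w) \<in> ?R\<^sup>*" if "(map g z, v) \<in> ?I\<^sup>*" "z \<in> D" for z v
    using that(1)
  proof induction
    case base
    then show ?case using that(2) by blast
  next
    case (step v u)
    then obtain w where w: "w \<in> D" "v = map g w" "(z, w) \<in> ?R\<^sup>*" by blast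
    obtain y where y: "y \<in> D" "u = map g y"
      using step(2) by (auto simp: induced_edges_def D'_def)
    have "(w, y) \<in> ?R"
      using edge[OF w(1) y(1)] step(2) w(2) y(2) by simp
    then show ?case
      using w(3) y by (blast intro: rtrancl_into_rtrancl)
  qed
  have up_path: "(map g z, map g w) \<in> ?I\<^sup>*" if "(z, w) \<in> (?R \<inter> D \<times> D)\<^sup>*" for z w
    using that
  proof induction
    case (step y w)
    then have "(map g y, map g w) \<in> ?I"
      using edge by blast
    with step(3) show ?case
      by (rule rtrancl_into_rtrancl)
  qed blast
  have D': "finite D'" "D' \<subseteq> nlists k UNIV"
    using D(1) lenD by (auto simp: D'_def in_nlists_UNIV)
  have f_ge: "Min (set (map g z)) \<le> t_hat \<Theta> D' (map g z)" if "z \<in> Z" "\<nexists>w. low z w" for z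
  proof (rule t_hat_ge_Min[OF k down D'])
    have zD: "z \<in> D"
      using that(1) D(3) by blast
    then show "map g z \<in> D'"
      by (simp add: D'_def)
    fix v assume v: "(map g z, v) \<in> ?I\<^sup>*" "v \<notin> Domain ?I"
    then obtain w where w: "w \<in> D" "v = map g w" "(z, w) \<in> ?R\<^sup>*"
      using down_path zD by blast
    then have "Min (set z) \<le> Min (set w)"
      using v(2) end_iff that(2) unfolding low_def by (metis not_le)
    then show "Min (set (map g z)) \<le> Min (set v)"
      using strict_mono_on_leD[OF g(1) Min_U Min_U] Min_g zD w by metis
  qed
  \<comment> \<open>\<open>D\<close> keeps a path to the optimal end \<open>W z\<close>, and every
    end reached in \<open>D'\<close> is the image of an end of the whole graph, so none has a
    smaller minimum.\<close>
  have f_eq: "t_hat \<Theta> D' (map g z) = g (least z)" if "z \<in> Z" "\<exists>w. low z w" for z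
  proof -
    have zD: "z \<in> D"
      using that(1) D(3) by blast
    have path: "(z, W z) \<in> (?R \<inter> D \<times> D)\<^sup>*"
      using D(5) that(1) by (auto simp: Q_def)
    then have WD: "W z \<in> D"
      using zD by cases auto
    have W_low: "low z (W z)" "Min (set (W z)) = least z"
      using W(2)[OF that(2)] by auto
    have "t_hat \<Theta> D' (map g z) = Min (set (map g (W z)))"
    proof (rule t_hat_eq_Min[OF k down D'])
      show "map g z \<in> D'"
        using zD by (simp add: D'_def)
      show "(map g z, map g (W z)) \<in> ?I\<^sup>*"
        by (rule up_path[OF path])
      show "map g (W z) \<notin> Domain ?I"
        using end_iff[OF WD] W_low(1) by (simp add: low_def)
      show "Min (set (map g (W z))) < Min (set (map g z))"
        unfolding Min_g[OF WD] Min_g[OF zD]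
        using W_low(1) by (intro strict_mono_onD[OF g(1)] Min_U WD zD) (simp add: low_def)
      fix v assume v: "(map g z, v) \<in> ?I\<^sup>*" "v \<notin> Domain ?I"
      then obtain w where w: "w \<in> D" "v = map g w" "(z, w) \<in> ?R\<^sup>*"
        using down_path zD by blast
      have w_end: "w \<notin> Domain ?R"
        using v(2) w end_iff by blast
      have "Min (set (W z)) \<le> Min (set w)"
      proof (cases "low z w")
        case True
        then show ?thesis
          using least_le W_low(2) by simp
      next
        case False
        then have "Min (set z) \<le> Min (set w)"
          using w(3) w_end by (simp add: low_def)
        then show ?thesis
          using W_low(1) unfolding low_def by (meson less_imp_le order_trans)
      qed
      then show "Min (set (map g (W z))) \<le> Min (set v)"
        unfolding w(2) Min_g[OF WD] Min_g[OF w(1)]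
        by (intro strict_mono_on_leD[OF g(1)] Min_U WD w(1))
    qed
    then show ?thesis
      using Min_g[OF WD] W_low(2) by simp
  qed
  have least_U: "least z \<in> U" if "z \<in> Z" "\<exists>w. low z w" for z
  proof -
    have "(z, W z) \<in> (?R \<inter> D \<times> D)\<^sup>*"
      using D(5) that(1) by (auto simp: Q_def)
    then have "W z \<in> D"
      using that(1) D(3) by cases auto
    then show ?thesis
      using Min_U W(2)[OF that(2)] by metis
  qed

  \<comment> \<open>Regularity on the image of the limit points\<close>
  define E where "E = g ` F"
  have cardE: "card E = p"
    using F(2) card_image[OF inj_on_subset[OF inj FU]] by (simp add: E_def)
  have E_lists: "\<exists>z\<in>Z. x = map g z" if "x \<in> nlists k E" for x
  proof -
    have x: "set x \<subseteq> g ` F" "length x = k"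
      using that by (simp_all add: nlists_def E_def)
    have "set (map (inv_into F g) x) \<subseteq> F"
      using x(1) inv_into_into[of _ g F] by auto
    moreover have "map g (map (inv_into F g) x) = x"
      using x(1) f_inv_into_f[of _ g F] by (auto intro!: map_idI)
    ultimately show ?thesis
      using x(2) unfolding Z_def by (intro bexI[of _ "map (inv_into F g) x"]) (simp_all add: nlists_def)
  qed
  \<comment> \<open>The least values lie before \<open>(1, 0)\<close>, so this identity places their
    images below all of \<open>E\<close>.\<close>
  have MinE: "Min E = g (1, 0)"
  proof -
    have "(1, 0) \<le> a" if "a \<in> F" for a
      using F_pos[OF that] by (cases a) auto
    then have "Min F = (1, 0)"
      using F by (intro Min_eqI) auto
    then show ?thesis
      using Min_image_strict_mono[OF monotone_on_subset[OF g(1) FU] F(1)] F(3) by (auto simp: E_def)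
  qed
  have same_type: "same_order z z'" if "z \<in> Z" "z' \<in> Z" "order_type (map g z) = order_type (map g z')" for z z'
  proof -
    have "strict_mono_on (set z) g" "strict_mono_on (set z') g"
      using Z(2) FU that by (blast intro: monotone_on_subset[OF g(1)])+
    moreover have "same_order (map g z) (map g z')"
      using order_type_eqD[OF that(3)] Z(1) that by simp
    ultimately show ?thesis
      by (meson same_order_map same_order_sym same_order_trans)
  qed
  have "regressively_regular k (t_hat \<Theta> D') E"
    unfolding regressively_regular_def
  proof
    fix ot
    show "(\<forall>x\<in>nlists k E. \<forall>y\<in>nlists k E. order_type x = ot \<and> order_type y = ot \<longrightarrow>
          t_hat \<Theta> D' x = t_hat \<Theta> D' y \<and> t_hat \<Theta> D' y < Min E) \<or>
        (\<forall>x\<in>nlists k E. order_type x = ot \<longrightarrow> Min (set x) \<le> t_hat \<Theta> D' x)"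
    proof (cases "\<exists>z\<in>Z. order_type (map g z) = ot \<and> (\<exists>w. low z w)")
      case True
      then obtain z where z: "z \<in> Z" "order_type (map g z) = ot" "\<exists>w. low z w" by blast
      have val: "t_hat \<Theta> D' x = g (least z)" if x: "x \<in> nlists k E" "order_type x = ot" for x
      proof -
        obtain z' where z': "z' \<in> Z" "x = map g z'"
          using E_lists[OF x(1)] by blast
        then have "(\<exists>w. low z' w) \<and> least z' = least z"
          using least_same[OF z(1) z'(1) same_type z(3)] z z' x(2) by simp
        then show ?thesis
          using f_eq z' by simp
      qed
      have "least z < (1, 0)"
        using least_same[OF z(1,1) _ z(3)] by (simp add: same_order_def)
      then have "g (least z) < Min E"
        unfolding MinE using least_U[OF z(1,3)] F(3) FU by (intro strict_mono_onD[OF g(1)]) auto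
      then show ?thesis
        using val by simp
    next
      case False
      have "Min (set x) \<le> t_hat \<Theta> D' x" if x: "x \<in> nlists k E" "order_type x = ot" for x
      proof -
        obtain z where z: "z \<in> Z" "x = map g z"
          using E_lists[OF x(1)] by blast
        then show ?thesis
          using f_ge[OF z(1)] False x(2) by blast
      qed
      then show ?thesis
        by blast
    qed
  qed
  moreover have "nlists k E \<subseteq> D'"
    using E_lists D(3) by (auto simp: D'_def)
  ultimately show ?thesis
    using D' cardE by blast
qed

theorem theorem4p2:
  fixes p k :: nat and \<Theta> :: "nat list rel"
  assumes subtle_cardinals: "\<forall>n\<ge>1. \<exists>r :: 'u rel. Card_order r \<and> n_subtle n r"
    and "p \<ge> 2" and "k \<ge> 2"
    and "downward_lattice_graph k \<Theta>"
  shows "(\<exists>(D, f)\<in>terminal_label_functions k \<Theta>. \<exists>E :: nat set.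
            card E = p \<and> nlists k E \<subseteq> D \<and> card (regressive_values f (nlists k E)) \<le> k ^ k)
       \<and> (\<exists>(D, f)\<in>terminal_label_functions k \<Theta>. \<exists>E :: nat set.
            card E = p \<and> nlists k E \<subseteq> D \<and> regressively_regular k f E)"
proof -
  obtain D E where D: "finite D" "D \<subseteq> nlists k UNIV"
    and E: "card E = p" "nlists k E \<subseteq> D" "regressively_regular k (t_hat \<Theta> D) E"
    using exists_regressively_regular[of k p \<Theta>] assms by auto
  have "(D, t_hat \<Theta> D) \<in> terminal_label_functions k \<Theta>"
    using D by (auto simp: terminal_label_functions_def)
  then show ?thesis
    using E card_regressive_values_le[OF E(3)] by blast
qed

end
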